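(* Let $H:\mathbb{R}^d\to\mathbb{R}$ be $C^2$ with bounded second derivatives, i.e. $\max_p |D^2H(p)|_2\le M_H$ for some constant $M_H$, strictly convex, and strongly coercive, i.e. $\lim_{|p|\to\infty} H(p)/|p|=+\infty$. Let $u_0:\mathbb{R}^d\to\mathbb{R}$ be bounded and Lipschitz continuous. Let $u$ be the unique viscosity solution of $$u_t+H(Du)=0 \ \text{ in } \mathbb{R}^d\times\mathbb{R}^+,\qquad u(x,0)=u_0(x).$$ For each time step $\Delta t>0$ and each space grid of $\mathbb{R}^d$ with nodes $\{x_j\}_{j\in\mathbb{N}}$ and mesh size $\Delta x$, let $V^n=(v_j^n)_{j\in\mathbb{N}}$, $n\ge 0$, be defined by $$v_j^{0}=u_0(x_j),\qquad v_j^{n+1}=\min_{k\in\mathbb{N}}\left\{v_k^n+\Delta t\,H^*\left(\frac{x_j-x_k}{\Delta t}\right)\right\}.$$ Assume in addition that $\Delta x=o(\Delta t)$. Then, for any $T>0$, the numerical solution $V^n$ converges to $u(x,t_n)$ locally uniformly on $\mathbb{R}^d\times[0,T]$ as $\Delta t,\Delta x\to 0$.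
   Context: $H^*(q)=\sup_{p\in\mathbb{R}^d}\{p\cdot q-H(p)\}$ is the Legendre transform of $H$. $|\cdot|_2$ denotes the matrix norm induced by the Euclidean norm. $t_n=n\Delta t$. The space grid is a (locally finite) subdivision of the whole of $\mathbb{R}^d$ into bounded elements, with countably many nodes $x_j$ (the vertices of the elements). No assumption is made on the regularity of the grid or on the shape of the elements. $\Delta x$ is the maximum diameter of the grid elements; in particular every point of $\mathbb{R}^d$ is within distance $\Delta x$ of some node. The value $v_j^n$ is the approximation of $u(x_j,t_n)$. The limit is taken along any family of time steps and grids with $\Delta t\to0$, $\Delta x\to 0$ and $\Delta x/\Delta t\to 0$. Local uniform convergence on $\mathbb{R}^d\times[0,T]$ means that for every compact $K\subset\mathbb{R}^d$, $\sup\{|v_j^n-u(x_j,t_n)| : x_j\in K,\ 0\le t_n\le T\}\to 0$. *)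

theory Defs
  imports "HOL-Analysis.Analysis" "HOL-Library.Landau_Symbols"
begin

definition strictly_convex :: "('a::real_vector \<Rightarrow> real) \<Rightarrow> bool" where
  "strictly_convex f \<longleftrightarrow>
     (\<forall>x y s. x \<noteq> y \<longrightarrow> 0 < s \<longrightarrow> s < 1 \<longrightarrow>
        f ((1 - s) *\<^sub>R x + s *\<^sub>R y) < (1 - s) * f x + s * f y)"

definition strongly_coercive :: "('a::real_normed_vector \<Rightarrow> real) \<Rightarrow> bool" where
  "strongly_coercive f \<longleftrightarrow> filterlim (\<lambda>p. f p / norm p) at_top at_infinity"

definition C2_with_hessian ::
    "(real ^ 'd \<Rightarrow> real) \<Rightarrow> (real ^ 'd \<Rightarrow> real ^ 'd ^ 'd) \<Rightarrow> bool" where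
  "C2_with_hessian H D2H \<longleftrightarrow>
     (\<exists>DH :: real ^ 'd \<Rightarrow> real ^ 'd.
        (\<forall>p. GDERIV H p :> DH p) \<and>
        (\<forall>p. (DH has_derivative (\<lambda>h. D2H p *v h)) (at p))) \<and>
     continuous_on UNIV D2H"

(* The supremum is taken in the reals: for strongly coercive, continuous H the set is
   bounded above, so that no value +infinity occurs. *)
definition legendre :: "('a::real_inner \<Rightarrow> real) \<Rightarrow> 'a \<Rightarrow> real" where
  "legendre H q = (SUP p. p \<bullet> q - H p)"


(* phi is C^1 on the open set x in R^d, t > 0, with spatial gradient Dphi and time derivative
   phit; the values of phi for t <= 0 are irrelevant. *)
definition C1_test_function ::
    "('a::euclidean_space \<Rightarrow> real \<Rightarrow> real) \<Rightarrow> ('a \<Rightarrow> real \<Rightarrow> 'a) \<Rightarrow> ('a \<Rightarrow> real \<Rightarrow> real) \<Rightarrow> bool" where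
  "C1_test_function \<phi> D\<phi> \<phi>t \<longleftrightarrow>
     (\<forall>x t. 0 < t \<longrightarrow>
        ((\<lambda>(y, s). \<phi> y s) has_derivative (\<lambda>(h, k). D\<phi> x t \<bullet> h + \<phi>t x t * k)) (at (x, t))) \<and>
     continuous_on (UNIV \<times> {0<..}) (\<lambda>(x, t). D\<phi> x t) \<and>
     continuous_on (UNIV \<times> {0<..}) (\<lambda>(x, t). \<phi>t x t)"

definition viscosity_subsolution ::
    "('a::euclidean_space \<Rightarrow> real) \<Rightarrow> ('a \<Rightarrow> real \<Rightarrow> real) \<Rightarrow> bool" where
  "viscosity_subsolution H u \<longleftrightarrow>
     (\<forall>\<phi> D\<phi> \<phi>t x t. C1_test_function \<phi> D\<phi> \<phi>t \<longrightarrow> 0 < t \<longrightarrow>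
        (\<forall>\<^sub>F (y, s) in nhds (x, t). u y s - \<phi> y s \<le> u x t - \<phi> x t) \<longrightarrow>
        \<phi>t x t + H (D\<phi> x t) \<le> 0)"

definition viscosity_supersolution ::
    "('a::euclidean_space \<Rightarrow> real) \<Rightarrow> ('a \<Rightarrow> real \<Rightarrow> real) \<Rightarrow> bool" where
  "viscosity_supersolution H u \<longleftrightarrow>
     (\<forall>\<phi> D\<phi> \<phi>t x t. C1_test_function \<phi> D\<phi> \<phi>t \<longrightarrow> 0 < t \<longrightarrow>
        (\<forall>\<^sub>F (y, s) in nhds (x, t). u y s - \<phi> y s \<ge> u x t - \<phi> x t) \<longrightarrow>
        \<phi>t x t + H (D\<phi> x t) \<ge> 0)"

(* Viscosity solution of the Cauchy problem u_t + H(Du) = 0 for t > 0, u(x,0) = u0(x).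
   Boundedness on R^d x [0,T] for every finite T fixes the class in which the solution is unique;
   global boundedness in time would be too much to ask, since u = -t H(0) for u0 = 0. *)
definition viscosity_solution ::
    "('a::euclidean_space \<Rightarrow> real) \<Rightarrow> ('a \<Rightarrow> real) \<Rightarrow> ('a \<Rightarrow> real \<Rightarrow> real) \<Rightarrow> bool" where
  "viscosity_solution H u\<^sub>0 u \<longleftrightarrow>
     continuous_on (UNIV \<times> {0..}) (\<lambda>(x, t). u x t) \<and>
     (\<forall>T>0. bounded ((\<lambda>(x, t). u x t) ` (UNIV \<times> {0..T}))) \<and>
     viscosity_subsolution H u \<and> viscosity_supersolution H u \<and>
     (\<forall>x. u x 0 = u\<^sub>0 x)"


(* A grid is given by its set E of elements, a map vert assigning to each element its vertices, and
   an enumeration X of the nodes. As elements have arbitrary shape, their vertices are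
   part of the data: a finite nonempty subset of the closure. *)
definition space_grid ::
    "'a::euclidean_space set set \<Rightarrow> ('a set \<Rightarrow> 'a set) \<Rightarrow> (nat \<Rightarrow> 'a) \<Rightarrow> bool" where
  "space_grid E vert X \<longleftrightarrow>
     \<Union>E = UNIV \<and>
     pairwise (\<lambda>K L. interior K \<inter> interior L = {}) E \<and>
     locally_finite_in euclidean E \<and>
     (\<forall>K\<in>E. bounded K) \<and>
     bdd_above (diameter ` E) \<and>
     (\<forall>K\<in>E. finite (vert K) \<and> vert K \<noteq> {} \<and> vert K \<subseteq> closure K) \<and>
     range X = (\<Union>K\<in>E. vert K)"

definition mesh_size :: "'a::metric_space set set \<Rightarrow> real" where
  "mesh_size E = (SUP K\<in>E. diameter K)"

(* LEAST is the minimum of the set of values, which is attained on a space grid when H is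
   strongly coercive and u0 is bounded. *)
primrec scheme ::
    "('a::real_inner \<Rightarrow> real) \<Rightarrow> ('a \<Rightarrow> real) \<Rightarrow> real \<Rightarrow> (nat \<Rightarrow> 'a) \<Rightarrow> nat \<Rightarrow> nat \<Rightarrow> real" where
  "scheme H u\<^sub>0 \<Delta>t X 0 j = u\<^sub>0 (X j)"
| "scheme H u\<^sub>0 \<Delta>t X (Suc n) j =
     (LEAST w. w \<in> range (\<lambda>k. scheme H u\<^sub>0 \<Delta>t X n k + \<Delta>t * legendre H ((X j - X k) /\<^sub>R \<Delta>t)))"

(* The supremum is taken in [0,infinity], where the empty supremum is 0. *)
definition local_error ::
    "('a \<Rightarrow> real \<Rightarrow> real) \<Rightarrow> real \<Rightarrow> (nat \<Rightarrow> 'a) \<Rightarrow> (nat \<Rightarrow> nat \<Rightarrow> real) \<Rightarrow> 'a set \<Rightarrow> real \<Rightarrow> ennreal" where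
  "local_error u \<Delta>t X v K T =
     (SUP (j, n) \<in> {(j, n). X j \<in> K \<and> real n * \<Delta>t \<le> T}. ennreal \<bar>v n j - u (X j) (real n * \<Delta>t)\<bar>)"

end

theory Submission
  imports Defs
begin

text \<open>
  The solution \<open>u\<close> is given by the Hopf--Lax formula: \<open>u x t\<close> is the infimum over \<open>y\<close> of
  \<open>u\<^sub>0 y + t H\<^sup>*((x - y) / t)\<close>, and the scheme is this formula iterated with all points restricted to
  the nodes. The proof bounds the viscosity solution by the formula from both sides and then compares
  the scheme with it.

  Both bounds come from one comparison principle (\<open>classical_subsolution_le_supersolution\<close>): a
  viscosity supersolution stays above every \<open>C\<^sup>1\<close> classical subsolution that lies below it initially and
  outside a large ball.

  \<^item> Upper bound (\<open>viscosity_solution_le_hopf_lax\<close>). For a fixed velocity \<open>q\<close>, the inequality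
    \<open>H p \<ge> p \<bullet> q - H\<^sup>* q\<close> shows that every exact solution of the transport equation
    \<open>u\<^sub>t + q \<bullet> Du = H\<^sup>* q\<close> is a classical supersolution. A steep paraboloid around the moving point
    \<open>y + s q\<close>, raised slightly, is such a solution, and it dominates the Lipschitz datum initially.
  \<^item> Lower bound (\<open>hopf_lax_le_viscosity_solution\<close>). If every \<open>y\<close> has Hopf--Lax value above \<open>c\<close> at
    \<open>(x\<^sub>0, t\<^sub>0)\<close>, then every \<open>y\<close> has a slope \<open>p\<close> for which the affine solution
    \<open>u\<^sub>0 y + p \<bullet> (x - y) - t H p\<close> still exceeds \<open>c\<close> at \<open>(x\<^sub>0, t\<^sub>0)\<close>, while it touches the datum at \<open>y\<close>. By
    compactness, finitely many of these affine solutions have a minimum that is initially at most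
    \<open>u\<^sub>0 + \<epsilon>\<close> on a large ball, and further affine solutions push the minimum down outside it. The minimum
    is not smooth, but its smoothing \<open>- ln (\<Sum> exp (- l w\<^sub>i)) / l\<close> is again a classical
    subsolution: its gradient is a convex combination of the slopes, so that Jensen's inequality
    for \<open>H\<close> applies.

  The scheme is never below \<open>u\<close>: summing \<open>\<Delta>t H\<^sup>* ((x\<^sub>j - x\<^sub>k) / \<Delta>t) \<ge> p \<bullet> (x\<^sub>j - x\<^sub>k) - \<Delta>t H p\<close> along a chain
  of minimising nodes gives a Hopf--Lax value at its starting node. For the opposite estimate, the
  straight path from a nearly optimal \<open>y\<close> to \<open>x\<^sub>j\<close> is shadowed by nodes. Its velocity \<open>q\<close> is
  bounded by a constant, because \<open>H\<^sup>*\<close> grows superlinearly and \<open>u\<^sub>0\<close> is Lipschitz, and the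
  velocities of the shadowing path differ from \<open>q\<close> by at most \<open>2 \<Delta>x / \<Delta>t\<close>, which tends to zero;
  uniform continuity of \<open>H\<^sup>*\<close> on balls turns this into a small error in the cost.
\<close>

section \<open>Comparison with classical subsolutions\<close>

text \<open>
  Subtracting \<open>\<delta> exp (l (t - t\<^sub>0))\<close> with large \<open>l\<close> does two things at once: it makes the subsolution
  strict, and it rules out a maximum of the difference at the terminal time \<open>t\<^sub>0 + 1\<close>, while it costs
  only \<open>\<delta>\<close> at time \<open>t\<^sub>0\<close>. A positive maximum of the difference is then attained in the interior,
  where the definition of a supersolution contradicts strictness.
\<close>

lemma classical_subsolution_le_supersolution:
  fixes H :: "'a::euclidean_space \<Rightarrow> real"
  assumes super: "viscosity_supersolution H u"
    and u_cont: "continuous_on (UNIV \<times> {0..}) (\<lambda>(x, t). u x t)"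
    and test: "C1_test_function \<phi> D\<phi> \<phi>t"
    and sub: "\<And>x t. 0 < t \<Longrightarrow> \<phi>t x t + H (D\<phi> x t) \<le> 0"
    and \<phi>_cont: "continuous_on (UNIV \<times> {0..}) (\<lambda>(x, t). \<phi> x t)"
    and initial: "\<And>x. \<phi> x 0 \<le> u x 0"
    and far: "\<And>x t. \<rho> \<le> norm x \<Longrightarrow> 0 \<le> t \<Longrightarrow> t \<le> t\<^sub>0 + 1 \<Longrightarrow> \<phi> x t \<le> u x t"
    and "0 < t\<^sub>0"
  shows "\<phi> x\<^sub>0 t\<^sub>0 \<le> u x\<^sub>0 t\<^sub>0"
proof (rule ccontr)
  assume contra: "\<not> \<phi> x\<^sub>0 t\<^sub>0 \<le> u x\<^sub>0 t\<^sub>0"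
  define \<delta> where "\<delta> = (\<phi> x\<^sub>0 t\<^sub>0 - u x\<^sub>0 t\<^sub>0) / 2"
  have "0 < \<delta>" using contra by (simp add: \<delta>_def)
  define S where "S = cball (0::'a) \<rho> \<times> {0..t\<^sub>0 + 1}"
  have "compact S" by (simp add: S_def compact_Times)
  have in_S: "(x\<^sub>0, t\<^sub>0) \<in> S"
    using contra far[of x\<^sub>0 t\<^sub>0] \<open>0 < t\<^sub>0\<close> by (force simp: S_def)
  have "S \<subseteq> UNIV \<times> {0..}" by (auto simp: S_def)
  then have f_cont: "continuous_on S (\<lambda>z. \<phi> (fst z) (snd z) - u (fst z) (snd z))"
    using continuous_on_subset[OF u_cont] continuous_on_subset[OF \<phi>_cont]
    by (intro continuous_on_diff) (auto simp: case_prod_unfold)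
  obtain z\<^sub>m where "\<And>z. z \<in> S \<Longrightarrow>
      \<phi> (fst z) (snd z) - u (fst z) (snd z) \<le> \<phi> (fst z\<^sub>m) (snd z\<^sub>m) - u (fst z\<^sub>m) (snd z\<^sub>m)"
    using continuous_attains_sup[OF \<open>compact S\<close> _ f_cont] in_S by blast
  then obtain M where M: "\<And>x t. (x, t) \<in> S \<Longrightarrow> \<phi> x t - u x t \<le> M"
    by force
  \<comment> \<open>This rate makes the penalty exceed the bound \<open>M\<close> one unit of time after \<open>t\<^sub>0\<close>.\<close>
  define l where "l = (\<bar>M\<bar> + 1) / \<delta>"
  have "0 < l" using \<open>0 < \<delta>\<close> by (simp add: l_def)
  have "\<delta> * l = \<bar>M\<bar> + 1" using \<open>0 < \<delta>\<close> by (simp add: l_def)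
  then have "M < \<delta> * (1 + l)"
    using \<open>0 < \<delta>\<close> by (simp add: distrib_left)
  also have "\<dots> \<le> \<delta> * exp l"
    using \<open>0 < \<delta>\<close> by (intro mult_left_mono exp_ge_add_one_self) auto
  finally have penalty: "M < \<delta> * exp l" .
  define \<psi> where "\<psi> x t = \<phi> x t - \<delta> * exp (l * (t - t\<^sub>0))" for x t
  have "continuous_on S (\<lambda>z. \<psi> (fst z) (snd z) - u (fst z) (snd z))"
  proof -
    have "continuous_on S (\<lambda>z. (\<phi> (fst z) (snd z) - u (fst z) (snd z)) - \<delta> * exp (l * (snd z - t\<^sub>0)))"
      by (intro continuous_intros f_cont)
    then show ?thesis by (simp add: \<psi>_def algebra_simps)
  qed
  from continuous_attains_sup[OF \<open>compact S\<close> _ this] in_S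
  obtain x\<^sub>1 t\<^sub>1 where z\<^sub>1: "(x\<^sub>1, t\<^sub>1) \<in> S"
    and max: "\<And>x t. (x, t) \<in> S \<Longrightarrow> \<psi> x t - u x t \<le> \<psi> x\<^sub>1 t\<^sub>1 - u x\<^sub>1 t\<^sub>1"
    by (metis empty_iff fst_conv snd_conv surj_pair)
  have "\<psi> x\<^sub>0 t\<^sub>0 - u x\<^sub>0 t\<^sub>0 = \<delta>"
    by (simp add: \<psi>_def \<delta>_def field_simps)
  with max[OF in_S] \<open>0 < \<delta>\<close> have pos: "0 < \<psi> x\<^sub>1 t\<^sub>1 - u x\<^sub>1 t\<^sub>1" by simp
  then have pos': "0 < \<phi> x\<^sub>1 t\<^sub>1 - u x\<^sub>1 t\<^sub>1"
    using \<open>0 < \<delta>\<close> by (simp add: \<psi>_def) (smt (verit) exp_gt_zero mult_pos_pos)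
  have "t\<^sub>1 \<noteq> 0" using pos' initial[of x\<^sub>1] by auto
  moreover have "t\<^sub>1 \<noteq> t\<^sub>0 + 1"
    using pos M[OF z\<^sub>1] penalty by (auto simp: \<psi>_def)
  moreover have "norm x\<^sub>1 < \<rho>"
    using pos' far[of x\<^sub>1 t\<^sub>1] z\<^sub>1 by (force simp: S_def)
  ultimately have interior: "(x\<^sub>1, t\<^sub>1) \<in> ball 0 \<rho> \<times> {0<..<t\<^sub>0 + 1}"
    using z\<^sub>1 by (auto simp: S_def)
  have "C1_test_function \<psi> D\<phi> (\<lambda>x t. \<phi>t x t - \<delta> * (l * exp (l * (t - t\<^sub>0))))"
    unfolding C1_test_function_def
  proof (intro conjI allI impI)
    fix x :: 'a and t :: real assume "0 < t"
    with test have "((\<lambda>(y, s). \<phi> y s) has_derivative (\<lambda>(h, k). D\<phi> x t \<bullet> h + \<phi>t x t * k)) (at (x, t))"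
      by (simp add: C1_test_function_def)
    then have "((\<lambda>z. \<phi> (fst z) (snd z)) has_derivative
        (\<lambda>z. D\<phi> x t \<bullet> fst z + \<phi>t x t * snd z)) (at (x, t))"
      by (simp add: case_prod_unfold)
    then have "((\<lambda>z. \<phi> (fst z) (snd z) - \<delta> * exp (l * (snd z - t\<^sub>0))) has_derivative
        (\<lambda>z. (D\<phi> x t \<bullet> fst z + \<phi>t x t * snd z) - \<delta> * (l * snd z * exp (l * (snd (x, t) - t\<^sub>0))))) (at (x, t))"
      by (auto intro!: derivative_eq_intros)
    then show "((\<lambda>(y, s). \<psi> y s) has_derivative
        (\<lambda>(h, k). D\<phi> x t \<bullet> h + (\<phi>t x t - \<delta> * (l * exp (l * (t - t\<^sub>0)))) * k)) (at (x, t))"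
      by (simp add: case_prod_unfold \<psi>_def algebra_simps)
  next
    show "continuous_on (UNIV \<times> {0<..}) (\<lambda>(x, t). D\<phi> x t)"
      using test by (simp add: C1_test_function_def)
    have "continuous_on (UNIV \<times> {0<..}) (\<lambda>z. \<phi>t (fst z) (snd z))"
      using test by (simp add: C1_test_function_def case_prod_unfold)
    then show "continuous_on (UNIV \<times> {0<..}) (\<lambda>(x, t). \<phi>t x t - \<delta> * (l * exp (l * (t - t\<^sub>0))))"
      unfolding case_prod_unfold by (intro continuous_intros)
  qed
  moreover have "\<forall>\<^sub>F (y, s) in nhds (x\<^sub>1, t\<^sub>1). u y s - \<psi> y s \<ge> u x\<^sub>1 t\<^sub>1 - \<psi> x\<^sub>1 t\<^sub>1"
  proof -
    have "\<forall>\<^sub>F z in nhds (x\<^sub>1, t\<^sub>1). z \<in> ball 0 \<rho> \<times> {0<..<t\<^sub>0 + 1}"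
      using interior by (intro eventually_nhds_in_open open_Times) auto
    then show ?thesis
    proof eventually_elim
      case (elim z)
      with max[of "fst z" "snd z"] show ?case by (auto simp: S_def split: prod.split)
    qed
  qed
  ultimately have "\<phi>t x\<^sub>1 t\<^sub>1 - \<delta> * (l * exp (l * (t\<^sub>1 - t\<^sub>0))) + H (D\<phi> x\<^sub>1 t\<^sub>1) \<ge> 0"
    using super[unfolded viscosity_supersolution_def, rule_format, of \<psi> D\<phi> _ t\<^sub>1 x\<^sub>1] interior by auto
  moreover have "0 < \<delta> * (l * exp (l * (t\<^sub>1 - t\<^sub>0)))"
    using \<open>0 < \<delta>\<close> \<open>0 < l\<close> by simp
  ultimately show False using sub[of t\<^sub>1 x\<^sub>1] interior by auto
qed

text \<open>
  This reflection turns comparison from below into comparison from above, with the Hamiltonian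
  \<open>\<lambda>p. - H (- p)\<close>. This Hamiltonian is concave for convex \<open>H\<close>, which is why the comparison principle
  is stated for arbitrary Hamiltonians.
\<close>

lemma viscosity_supersolution_uminus:
  assumes "viscosity_subsolution H u"
  shows "viscosity_supersolution (\<lambda>p. - H (- p)) (\<lambda>x t. - u x t)"
  unfolding viscosity_supersolution_def
proof (intro allI impI)
  fix \<phi> D\<phi> \<phi>t x and t :: real
  assume test: "C1_test_function \<phi> D\<phi> \<phi>t" and "0 < t"
    and min: "\<forall>\<^sub>F (y, s) in nhds (x, t). - u y s - \<phi> y s \<ge> - u x t - \<phi> x t"
  have "C1_test_function (\<lambda>x t. - \<phi> x t) (\<lambda>x t. - D\<phi> x t) (\<lambda>x t. - \<phi>t x t)"
    unfolding C1_test_function_def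
  proof (intro conjI allI impI)
    fix x :: 'a and t :: real assume "0 < t"
    with test have "((\<lambda>(y, s). \<phi> y s) has_derivative (\<lambda>(h, k). D\<phi> x t \<bullet> h + \<phi>t x t * k)) (at (x, t))"
      by (simp add: C1_test_function_def)
    from has_derivative_minus[OF this]
    show "((\<lambda>(y, s). - \<phi> y s) has_derivative (\<lambda>(h, k). - D\<phi> x t \<bullet> h + - \<phi>t x t * k)) (at (x, t))"
      by (simp add: case_prod_unfold)
  qed (use test in \<open>auto simp: C1_test_function_def case_prod_unfold intro!: continuous_on_minus\<close>)
  moreover have "\<forall>\<^sub>F (y, s) in nhds (x, t). u y s - - \<phi> y s \<le> u x t - - \<phi> x t"
    using min by eventually_elim auto
  ultimately have "- \<phi>t x t + H (- D\<phi> x t) \<le> 0"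
    using assms \<open>0 < t\<close> unfolding viscosity_subsolution_def by blast
  then show "0 \<le> \<phi>t x t + - H (- D\<phi> x t)" by simp
qed

lemma viscosity_solution_bounded_on_slab:
  assumes "viscosity_solution H u\<^sub>0 u" and "0 < T"
  obtains B where "0 \<le> B" "\<And>x t. 0 \<le> t \<Longrightarrow> t \<le> T \<Longrightarrow> \<bar>u x t\<bar> \<le> B"
proof -
  have "bounded ((\<lambda>(x, t). u x t) ` (UNIV \<times> {0..T}))"
    using assms unfolding viscosity_solution_def by blast
  then obtain B where B: "\<forall>v \<in> (\<lambda>(x, t). u x t) ` (UNIV \<times> {0..T}). norm v \<le> B"
    unfolding bounded_iff by blast
  then have *: "\<bar>u x t\<bar> \<le> B" if "0 \<le> t" "t \<le> T" for x t
    using that by force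
  have "0 \<le> B" using *[of 0 undefined] assms(2) by simp
  with * show ?thesis by (rule that[rotated])
qed

section \<open>The viscosity solution and the Hopf--Lax formula\<close>

text \<open>
  The Legendre transform appears only through the affine functions whose supremum it is, here and
  in the converse bound below. This is the form in which the scheme delivers its lower bound.
\<close>

lemma viscosity_solution_le_hopf_lax:
  fixes H :: "'a::euclidean_space \<Rightarrow> real"
  assumes sol: "viscosity_solution H u\<^sub>0 u" and lip: "L-lipschitz_on UNIV u\<^sub>0" and "0 < t"
    and c: "\<And>p. u\<^sub>0 y + p \<bullet> (x - y) - t * H p \<le> c"
  shows "u x t \<le> c"
proof (rule field_le_epsilon)
  fix \<epsilon> :: real assume "0 < \<epsilon>"
  define q where "q = (x - y) /\<^sub>R t"
  define r where "r = (c - u\<^sub>0 y) / t"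
  have fenchel: "p \<bullet> q - H p \<le> r" for p
  proof -
    have "p \<bullet> q = p \<bullet> (x - y) / t" by (simp add: q_def divide_inverse_commute)
    then show ?thesis using c[of p] \<open>0 < t\<close> by (simp add: r_def field_simps)
  qed
  \<comment> \<open>By Young's inequality, \<open>L d \<le> \<epsilon> + A d\<^sup>2\<close> for all \<open>d \<ge> 0\<close>, so the paraboloid lies above the Lipschitz
    datum; the summand \<open>1\<close> makes it grow even when \<open>L = 0\<close>.\<close>
  define A where "A = L\<^sup>2 / \<epsilon> + 1"
  have "1 \<le> A" using \<open>0 < \<epsilon>\<close> by (simp add: A_def)
  \<comment> \<open>An exact solution of the transport equation \<open>\<psi>\<^sub>t + q \<bullet> D\<psi> = r\<close>, where \<open>r\<close> bounds \<open>H\<^sup>* q\<close>.\<close>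
  define \<psi> where "\<psi> z s = u\<^sub>0 y + \<epsilon> + A * ((z - y - s *\<^sub>R q) \<bullet> (z - y - s *\<^sub>R q)) + s * r" for z s
  define T where "T = t + 1"
  obtain B where B: "0 \<le> B" "\<And>x s. 0 \<le> s \<Longrightarrow> s \<le> T \<Longrightarrow> \<bar>u x s\<bar> \<le> B"
    using viscosity_solution_bounded_on_slab[OF sol, of T] \<open>0 < t\<close> by (auto simp: T_def)
  have "- \<psi> x t \<le> - u x t"
  proof (rule classical_subsolution_le_supersolution[where H = "\<lambda>p. - H (- p)" and u = "\<lambda>x t. - u x t" and \<phi> = "\<lambda>x t. - \<psi> x t"
        and D\<phi> = "\<lambda>z s. - (2 * A) *\<^sub>R (z - y - s *\<^sub>R q)"
        and \<phi>t = "\<lambda>z s. 2 * A * (q \<bullet> (z - y - s *\<^sub>R q)) - r"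
        and \<rho> = "norm y + T * norm q + (1 + 2 * B + T * \<bar>r\<bar>)"])
    show "viscosity_supersolution (\<lambda>p. - H (- p)) (\<lambda>x t. - u x t)"
      using sol by (intro viscosity_supersolution_uminus) (simp add: viscosity_solution_def)
    show "continuous_on (UNIV \<times> {0..}) (\<lambda>(x, t). - u x t)"
      using sol by (auto simp: viscosity_solution_def case_prod_unfold intro: continuous_on_minus)
    show "C1_test_function (\<lambda>x t. - \<psi> x t) (\<lambda>z s. - (2 * A) *\<^sub>R (z - y - s *\<^sub>R q))
        (\<lambda>z s. 2 * A * (q \<bullet> (z - y - s *\<^sub>R q)) - r)"
      unfolding C1_test_function_def
    proof (intro conjI allI impI)
      fix z :: 'a and s :: real
      define w where "w = z - y - s *\<^sub>R q"
      have "((\<lambda>v. fst v - y - snd v *\<^sub>R q) has_derivative (\<lambda>v. fst v - snd v *\<^sub>R q)) (at (z, s))"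
        by (auto intro!: derivative_eq_intros)
      from has_derivative_inner[OF this this]
      have "((\<lambda>v. (fst v - y - snd v *\<^sub>R q) \<bullet> (fst v - y - snd v *\<^sub>R q)) has_derivative
          (\<lambda>v. 2 * (w \<bullet> (fst v - snd v *\<^sub>R q)))) (at (z, s))"
        by (simp add: w_def inner_commute)
      then have "((\<lambda>v. - (u\<^sub>0 y + \<epsilon> + A * ((fst v - y - snd v *\<^sub>R q) \<bullet> (fst v - y - snd v *\<^sub>R q)) + snd v * r))
          has_derivative (\<lambda>v. - (A * (2 * (w \<bullet> (fst v - snd v *\<^sub>R q))) + snd v * r))) (at (z, s))"
        by (auto intro!: derivative_eq_intros simp: w_def inner_commute)
      then show "((\<lambda>(x, t). - \<psi> x t) has_derivative
          (\<lambda>(h, k). - (2 * A) *\<^sub>R (z - y - s *\<^sub>R q) \<bullet> h + (2 * A * (q \<bullet> (z - y - s *\<^sub>R q)) - r) * k))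
          (at (z, s))"
        by (simp add: case_prod_unfold \<psi>_def flip: w_def)
           (simp add: inner_diff_right inner_commute algebra_simps)
    qed (auto simp: case_prod_unfold intro!: continuous_intros)
    show "2 * A * (q \<bullet> (z - y - s *\<^sub>R q)) - r + - H (- (- (2 * A) *\<^sub>R (z - y - s *\<^sub>R q))) \<le> 0" for z s
      using fenchel[of "(2 * A) *\<^sub>R (z - y - s *\<^sub>R q)"] by (simp add: inner_commute)
    show "continuous_on (UNIV \<times> {0..}) (\<lambda>(x, t). - \<psi> x t)"
      unfolding case_prod_unfold \<psi>_def by (intro continuous_intros)
    show "- \<psi> z 0 \<le> - u z 0" for z
    proof -
      define d where "d = norm (z - y)"
      have "0 \<le> (L * d - \<epsilon>)\<^sup>2 / \<epsilon>" using \<open>0 < \<epsilon>\<close> by simp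
      also have "\<dots> = L\<^sup>2 / \<epsilon> * d\<^sup>2 - 2 * (L * d) + \<epsilon>"
        using \<open>0 < \<epsilon>\<close> by (simp add: field_simps power2_eq_square)
      finally have "2 * (L * d) \<le> \<epsilon> + L\<^sup>2 / \<epsilon> * d\<^sup>2" by simp
      moreover have "0 \<le> L * d"
        using lip by (simp add: d_def lipschitz_on_def)
      ultimately have "L * d \<le> \<epsilon> + A * d\<^sup>2"
        using zero_le_power2[of d] unfolding A_def distrib_right by linarith
      moreover have "u\<^sub>0 z - u\<^sub>0 y \<le> L * d"
        using lipschitz_onD[OF lip, of z y] by (simp add: d_def dist_norm)
      ultimately show ?thesis
        using sol by (simp add: \<psi>_def d_def viscosity_solution_def power2_norm_eq_inner)
    qed
    show "- \<psi> z s \<le> - u z s"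
      if far: "norm y + T * norm q + (1 + 2 * B + T * \<bar>r\<bar>) \<le> norm z" and s: "0 \<le> s" "s \<le> t + 1" for z s
    proof -
      define d where "d = norm (z - y - s *\<^sub>R q)"
      have "norm z \<le> d + norm y + norm (s *\<^sub>R q)"
        using norm_triangle_ineq[of "(z - y - s *\<^sub>R q) + y" "s *\<^sub>R q"]
          norm_triangle_ineq[of "z - y - s *\<^sub>R q" y] by (simp add: d_def)
      moreover have "norm (s *\<^sub>R q) \<le> T * norm q"
        using s by (simp add: T_def mult_right_mono)
      ultimately have d: "1 + 2 * B + T * \<bar>r\<bar> \<le> d" using far by simp
      have "0 \<le> T * \<bar>r\<bar>" using \<open>0 < t\<close> by (simp add: T_def)
      with d B(1) have "1 \<le> d" by linarith
      have "d * 1 \<le> d * d" using \<open>1 \<le> d\<close> by (intro mult_left_mono) auto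
      also have "\<dots> \<le> A * d\<^sup>2"
        using mult_right_mono[OF \<open>1 \<le> A\<close>, of "d * d"] by (simp add: power2_eq_square)
      finally have "1 + 2 * B + T * \<bar>r\<bar> \<le> A * d\<^sup>2" using d by simp
      moreover have "\<bar>s * r\<bar> \<le> T * \<bar>r\<bar>"
        using s by (simp add: abs_mult T_def mult_right_mono)
      moreover have "\<bar>u\<^sub>0 y\<bar> \<le> B"
        using B(2)[of 0 y] sol \<open>0 < t\<close> by (simp add: T_def viscosity_solution_def)
      moreover have "\<bar>u z s\<bar> \<le> B" using B(2)[of s z] s by (simp add: T_def)
      ultimately show ?thesis
        using \<open>0 < \<epsilon>\<close> by (simp add: \<psi>_def d_def power2_norm_eq_inner)
    qed
  qed fact
  moreover have "\<psi> x t = c + \<epsilon>"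
    using \<open>0 < t\<close> by (simp add: \<psi>_def q_def r_def)
  ultimately show "u x t \<le> c + \<epsilon>" by simp
qed

text \<open>
  A smooth approximation, from below, of the minimum of the affine solutions
  \<open>a + p \<bullet> x - t H p\<close>; the error is at most \<open>ln (card I) / l\<close>.
\<close>

definition softmin ::
    "('a::euclidean_space \<Rightarrow> real) \<Rightarrow> real \<Rightarrow> (real \<times> 'a) set \<Rightarrow> 'a \<Rightarrow> real \<Rightarrow> real" where
  "softmin H l I x t = - ln (\<Sum>(a, p)\<in>I. exp (- l * (a + p \<bullet> x - t * H p))) / l"

lemma softmin_le:
  assumes "finite I" "(a, p) \<in> I" "0 < l"
  shows "softmin H l I x t \<le> a + p \<bullet> x - t * H p"
proof -
  have "exp (- l * (a + p \<bullet> x - t * H p)) \<le> (\<Sum>(a, p)\<in>I. exp (- l * (a + p \<bullet> x - t * H p)))"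
    using member_le_sum[of "(a, p)" I "\<lambda>(a, p). exp (- l * (a + p \<bullet> x - t * H p))"] assms by auto
  then have "- l * (a + p \<bullet> x - t * H p) \<le> ln (\<Sum>(a, p)\<in>I. exp (- l * (a + p \<bullet> x - t * H p)))"
    by (smt (verit) exp_gt_zero ln_ge_iff)
  then show ?thesis
    using \<open>0 < l\<close> by (simp add: softmin_def field_simps)
qed

lemma softmin_ge:
  assumes "finite I" "I \<noteq> {}" "0 < l"
    and m: "\<And>a p. (a, p) \<in> I \<Longrightarrow> m \<le> a + p \<bullet> x - t * H p"
  shows "m - ln (card I) / l \<le> softmin H l I x t"
proof -
  let ?S = "\<Sum>(a, p)\<in>I. exp (- l * (a + p \<bullet> x - t * H p))"
  have card: "0 < real (card I)" using assms by (simp add: card_gt_0_iff)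
  have "0 < ?S" using assms by (intro sum_pos) auto
  have "?S \<le> real (card I) * exp (- l * m)"
    using m \<open>0 < l\<close> by (intro sum_bounded_above) auto
  then have "ln ?S \<le> ln (real (card I) * exp (- l * m))"
    using \<open>0 < ?S\<close> by (simp add: ln_mono)
  also have "\<dots> = ln (card I) - l * m"
    using card by (simp add: ln_mult)
  finally have "(l * m - ln (card I)) / l \<le> - ln ?S / l"
    using \<open>0 < l\<close> by (intro divide_right_mono) auto
  then show ?thesis
    using \<open>0 < l\<close> by (simp add: softmin_def diff_divide_distrib)
qed

text \<open>
  With the weights \<open>\<theta>\<^sub>i\<close> of the individual exponentials, the gradient is \<open>\<Sum> \<theta>\<^sub>i p\<^sub>i\<close> and the time
  derivative is \<open>- \<Sum> \<theta>\<^sub>i H p\<^sub>i\<close>, so the subsolution inequality is Jensen's inequality.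
\<close>

lemma softmin_classical_subsolution:
  fixes H :: "'a::euclidean_space \<Rightarrow> real"
  assumes "convex_on UNIV H" and "finite I" "I \<noteq> {}" "0 < l"
  obtains D\<phi> \<phi>t where
    "C1_test_function (softmin H l I) D\<phi> \<phi>t" "\<And>x t. \<phi>t x t + H (D\<phi> x t) \<le> 0"
proof
  define e where "e i z = exp (- l * (fst i + snd i \<bullet> fst z - snd z * H (snd i)))" for i and z :: "'a \<times> real"
  define W where "W z = (\<Sum>i\<in>I. e i z)" for z
  have W_pos: "0 < W z" for z
    unfolding W_def e_def using assms by (intro sum_pos) auto
  have e_cont: "continuous_on A (e i)" for i A
    unfolding e_def by (intro continuous_intros)
  have W_cont: "continuous_on A W" for A
    unfolding W_def by (intro continuous_intros e_cont)
  define D\<phi> where "D\<phi> x t = (\<Sum>i\<in>I. (e i (x, t) / W (x, t)) *\<^sub>R snd i)" for x t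
  define \<phi>t where "\<phi>t x t = - (\<Sum>i\<in>I. (e i (x, t) / W (x, t)) * H (snd i))" for x t
  have softmin: "softmin H l I x t = - ln (W (x, t)) / l" for x t
    by (simp add: softmin_def W_def e_def case_prod_unfold)
  show "C1_test_function (softmin H l I) D\<phi> \<phi>t"
    unfolding C1_test_function_def
  proof (intro conjI allI impI)
    fix x :: 'a and t :: real
    define \<theta> where "\<theta> i = e i (x, t) / W (x, t)" for i
    have e_deriv: "(e i has_derivative (\<lambda>v. - l * (snd i \<bullet> fst v - snd v * H (snd i)) * e i (x, t))) (at (x, t))" for i
      unfolding e_def by (auto intro!: derivative_eq_intros simp: algebra_simps)
    have "(W has_derivative (\<lambda>v. \<Sum>i\<in>I. - l * (snd i \<bullet> fst v - snd v * H (snd i)) * e i (x, t))) (at (x, t))"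
      unfolding W_def by (intro has_derivative_sum e_deriv)
    then have "((\<lambda>z. - ln (W z) / l) has_derivative
        (\<lambda>v. - (inverse (W (x, t)) * (\<Sum>i\<in>I. - l * (snd i \<bullet> fst v - snd v * H (snd i)) * e i (x, t))) / l)) (at (x, t))"
      using W_pos[of "(x, t)"] \<open>0 < l\<close> by (auto intro!: derivative_eq_intros)
    moreover have "- (inverse (W (x, t)) * (\<Sum>i\<in>I. - l * (snd i \<bullet> h - k * H (snd i)) * e i (x, t))) / l
        = D\<phi> x t \<bullet> h + \<phi>t x t * k" for h k
    proof -
      have "- (inverse (W (x, t)) * (\<Sum>i\<in>I. - l * (snd i \<bullet> h - k * H (snd i)) * e i (x, t))) / l
          = (\<Sum>i\<in>I. \<theta> i * (snd i \<bullet> h) - \<theta> i * H (snd i) * k)"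
        unfolding sum_distrib_left sum_negf[symmetric] sum_divide_distrib
        using \<open>0 < l\<close> W_pos[of "(x, t)"] by (intro sum.cong) (auto simp: \<theta>_def field_simps)
      also have "\<dots> = D\<phi> x t \<bullet> h + \<phi>t x t * k"
        unfolding D\<phi>_def \<phi>t_def \<theta>_def[symmetric]
        by (simp add: sum_subtractf inner_sum_left sum_distrib_right)
      finally show ?thesis .
    qed
    ultimately show "((\<lambda>(y, s). softmin H l I y s) has_derivative
        (\<lambda>(h, k). D\<phi> x t \<bullet> h + \<phi>t x t * k)) (at (x, t))"
      by (simp add: case_prod_unfold softmin)
  next
    show "continuous_on (UNIV \<times> {0<..}) (\<lambda>(x, t). D\<phi> x t)"
      unfolding D\<phi>_def case_prod_unfold prod.collapse
      using W_pos by (intro continuous_intros e_cont W_cont) (metis less_irrefl)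
    show "continuous_on (UNIV \<times> {0<..}) (\<lambda>(x, t). \<phi>t x t)"
      unfolding \<phi>t_def case_prod_unfold prod.collapse
      using W_pos by (intro continuous_intros e_cont W_cont) (metis less_irrefl)
  qed
  fix x t
  define \<theta> where "\<theta> i = e i (x, t) / W (x, t)" for i
  have "(\<Sum>i\<in>I. \<theta> i) = 1"
    using W_pos[of "(x, t)"] by (simp add: \<theta>_def W_def flip: sum_divide_distrib)
  moreover have "0 \<le> \<theta> i" for i
    using W_pos[of "(x, t)"] by (simp add: \<theta>_def e_def)
  ultimately have "H (\<Sum>i\<in>I. \<theta> i *\<^sub>R snd i) \<le> (\<Sum>i\<in>I. \<theta> i * H (snd i))"
    using convex_on_sum[OF \<open>finite I\<close> \<open>I \<noteq> {}\<close> \<open>convex_on UNIV H\<close>, of \<theta> snd] by simp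
  then show "\<phi>t x t + H (D\<phi> x t) \<le> 0"
    by (simp add: \<phi>t_def D\<phi>_def \<theta>_def)
qed

lemma continuous_on_softmin:
  assumes "finite I" "I \<noteq> {}" "0 < l"
  shows "continuous_on A (\<lambda>(x, t). softmin H l I x t)"
proof -
  have "(\<Sum>(a, p)\<in>I. exp (- l * (a + p \<bullet> fst z - snd z * H p))) \<noteq> 0" for z
    using assms sum_pos[of I "\<lambda>(a, p). exp (- l * (a + p \<bullet> fst z - snd z * H p))"] by force
  then show ?thesis
    using \<open>0 < l\<close> unfolding softmin_def case_prod_unfold by (intro continuous_intros) auto
qed

text \<open>
  The hypothesis says that every \<open>y\<close> has Hopf--Lax value above \<open>c\<close>, witnessed by a slope \<open>p y\<close>. Smoothing
  the minimum of finitely many of the resulting affine solutions yields a classical subsolution that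
  lies below \<open>u\<^sub>0\<close> initially and is almost \<open>c\<close> at \<open>(x\<^sub>0, t\<^sub>0)\<close>.
\<close>

lemma hopf_lax_le_viscosity_solution:
  fixes H :: "'a::euclidean_space \<Rightarrow> real"
  assumes "convex_on UNIV H" and sol: "viscosity_solution H u\<^sub>0 u" and "0 < t\<^sub>0"
    and "\<And>y. \<exists>p. c < u\<^sub>0 y + p \<bullet> (x\<^sub>0 - y) - t\<^sub>0 * H p"
  shows "c \<le> u x\<^sub>0 t\<^sub>0"
proof (rule ccontr)
  assume contra: "\<not> c \<le> u x\<^sub>0 t\<^sub>0"
  obtain p where p: "\<And>y. c < u\<^sub>0 y + p y \<bullet> (x\<^sub>0 - y) - t\<^sub>0 * H (p y)"
    using assms(4) by metis
  have u_cont: "continuous_on (UNIV \<times> {0..}) (\<lambda>(x, t). u x t)"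
    and u_0: "\<And>x. u x 0 = u\<^sub>0 x"
    using sol by (auto simp: viscosity_solution_def)
  have u\<^sub>0_cont: "continuous_on UNIV u\<^sub>0"
  proof -
    have "continuous_on UNIV ((\<lambda>(x, t). u x t) \<circ> (\<lambda>x. (x, 0)))"
      by (intro continuous_on_compose continuous_intros continuous_on_subset[OF u_cont]) auto
    then show ?thesis by (simp add: o_def u_0)
  qed
  obtain B where B: "0 \<le> B" "\<And>x t. 0 \<le> t \<Longrightarrow> t \<le> t\<^sub>0 + 1 \<Longrightarrow> \<bar>u x t\<bar> \<le> B"
    using viscosity_solution_bounded_on_slab[OF sol, of "t\<^sub>0 + 1"] \<open>0 < t\<^sub>0\<close> by auto
  \<comment> \<open>One \<open>\<epsilon>\<close> is lost in the finite cover, one in the smoothing, and the third gives the contradiction.\<close>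
  define \<epsilon> where "\<epsilon> = (c - u x\<^sub>0 t\<^sub>0) / 3"
  have "0 < \<epsilon>" using contra by (simp add: \<epsilon>_def)
  \<comment> \<open>The affine solutions with slopes \<open>\<plusminus>b\<close>, \<open>b\<close> a basis vector, have a minimum that tends to \<open>- \<infinity>\<close> in space;
    the constant \<open>C\<close> lifts them above \<open>c\<close> at \<open>(x\<^sub>0, t\<^sub>0)\<close>, and beyond radius \<open>\<rho>\<close>
    their minimum is at most \<open>- B \<le> u\<close>.\<close>
  define D :: "'a set" where "D = Basis \<union> uminus ` Basis"
  have D: "finite D" "D \<noteq> {}" by (auto simp: D_def)
  define h where "h = (\<Sum>b\<in>D. \<bar>H b\<bar>)"
  have H_D: "\<bar>H b\<bar> \<le> h" if "b \<in> D" for b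
    unfolding h_def using that D by (intro member_le_sum) auto
  have "0 \<le> h" by (simp add: h_def sum_nonneg)
  define C where "C = \<bar>c\<bar> + norm x\<^sub>0 + t\<^sub>0 * h"
  define \<rho> where "\<rho> = DIM('a) * (C + (t\<^sub>0 + 1) * h + B)"
  have C_mono: "c \<le> C + b \<bullet> x\<^sub>0 - t\<^sub>0 * H b" if "b \<in> D" for b
  proof -
    have "norm b = 1" using that by (auto simp: D_def)
    then have "\<bar>b \<bullet> x\<^sub>0\<bar> \<le> norm x\<^sub>0" using Cauchy_Schwarz_ineq2[of b x\<^sub>0] by simp
    moreover have "t\<^sub>0 * H b \<le> t\<^sub>0 * h"
      using H_D[OF that] \<open>0 < t\<^sub>0\<close> by (intro mult_left_mono) auto
    ultimately show ?thesis by (simp add: C_def)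
  qed
  have far: "\<exists>b\<in>D. C + b \<bullet> x - t * H b \<le> - B" if "\<rho> \<le> norm x" "0 \<le> t" "t \<le> t\<^sub>0 + 1" for x t
  proof -
    have "\<exists>b\<in>Basis. norm x / DIM('a) \<le> \<bar>x \<bullet> b\<bar>"
    proof (rule ccontr)
      assume "\<not> ?thesis"
      then have "(\<Sum>b\<in>Basis. \<bar>x \<bullet> b\<bar>) < (\<Sum>b\<in>(Basis::'a set). norm x / DIM('a))"
        by (intro sum_strict_mono) (auto simp: not_le)
      with norm_le_l1[of x] show False by simp
    qed
    then obtain b' where "b' \<in> Basis" "norm x / DIM('a) \<le> \<bar>x \<bullet> b'\<bar>" by blast
    then obtain b where b: "b \<in> D" "b \<bullet> x \<le> - (norm x / DIM('a))"
      by (cases "0 \<le> x \<bullet> b'") (auto simp: D_def inner_commute intro: that[of b'] that[of "- b'"])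
    have "C + (t\<^sub>0 + 1) * h + B \<le> norm x / DIM('a)"
      using that(1) by (simp add: \<rho>_def field_simps)
    moreover have "- (t * H b) \<le> (t\<^sub>0 + 1) * h"
    proof -
      have "t * - H b \<le> t * h"
        using H_D[OF b(1)] \<open>0 \<le> t\<close> by (intro mult_left_mono) auto
      also have "\<dots> \<le> (t\<^sub>0 + 1) * h"
        using that \<open>0 \<le> h\<close> by (intro mult_right_mono) auto
      finally show ?thesis by simp
    qed
    ultimately show ?thesis using b by force
  qed
  \<comment> \<open>Where the affine solution that touches the datum at \<open>y\<close> is initially below \<open>u\<^sub>0 + \<epsilon>\<close>.\<close>
  define U where "U y = {x. u\<^sub>0 y + p y \<bullet> (x - y) < u\<^sub>0 x + \<epsilon>}" for y
  have "open (U y)" for y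
    unfolding U_def by (intro open_Collect_less continuous_intros u\<^sub>0_cont)
  moreover have "cball 0 \<rho> \<subseteq> (\<Union>y\<in>UNIV. U y)"
  proof
    fix x have "x \<in> U x" using \<open>0 < \<epsilon>\<close> by (simp add: U_def)
    then show "x \<in> (\<Union>y\<in>UNIV. U y)" by blast
  qed
  ultimately obtain Y where Y: "finite Y" "cball 0 \<rho> \<subseteq> (\<Union>y\<in>Y. U y)"
    using compactE_image[OF compact_cball, of UNIV U 0 \<rho>] by metis
  define I where "I = (\<lambda>y. (u\<^sub>0 y - p y \<bullet> y, p y)) ` Y \<union> (\<lambda>b. (C, b)) ` D"
  have I: "finite I" "I \<noteq> {}" using Y D by (auto simp: I_def)
  \<comment> \<open>The summand \<open>1\<close> keeps \<open>l\<close> positive when \<open>I\<close> is a singleton.\<close>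
  define l where "l = (ln (card I) + 1) / \<epsilon>"
  have "1 \<le> card I" using I by (simp add: Suc_le_eq card_gt_0_iff)
  then have "0 \<le> ln (card I)" by simp
  then have "0 < l" using \<open>0 < \<epsilon>\<close> by (simp add: l_def)
  have l: "ln (card I) / l \<le> \<epsilon>"
    using \<open>0 \<le> ln (card I)\<close> \<open>0 < \<epsilon>\<close> by (simp add: l_def field_simps)
  obtain D\<phi> \<phi>t where test: "C1_test_function (softmin H l I) D\<phi> \<phi>t"
      and sub: "\<And>x t. \<phi>t x t + H (D\<phi> x t) \<le> 0"
    using softmin_classical_subsolution[OF assms(1) I \<open>0 < l\<close>] by metis
  have far': "softmin H l I x t \<le> - B" if x: "\<rho> \<le> norm x" "0 \<le> t" "t \<le> t\<^sub>0 + 1" for x t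
  proof -
    obtain b where b: "b \<in> D" "C + b \<bullet> x - t * H b \<le> - B" using far[OF x] by blast
    then have "softmin H l I x t \<le> C + b \<bullet> x - t * H b"
      by (intro softmin_le I \<open>0 < l\<close>) (auto simp: I_def)
    with b show ?thesis by simp
  qed
  have "softmin H l I x\<^sub>0 t\<^sub>0 - \<epsilon> \<le> u x\<^sub>0 t\<^sub>0"
  proof (rule classical_subsolution_le_supersolution[where H = H and u = u and \<phi> = "\<lambda>x t. softmin H l I x t - \<epsilon>"])
    show "viscosity_supersolution H u" using sol by (simp add: viscosity_solution_def)
    show "C1_test_function (\<lambda>x t. softmin H l I x t - \<epsilon>) D\<phi> \<phi>t"
      using test unfolding C1_test_function_def case_prod_unfold
      by (auto intro!: derivative_eq_intros)
    show "continuous_on (UNIV \<times> {0..}) (\<lambda>(x, t). softmin H l I x t - \<epsilon>)"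
      using continuous_on_softmin[OF I \<open>0 < l\<close>] unfolding case_prod_unfold
      by (intro continuous_intros)
    show "softmin H l I x 0 - \<epsilon> \<le> u x 0" for x
    proof (cases "\<rho> \<le> norm x")
      case True
      then show ?thesis using far'[of x 0] B(2)[of 0 x] \<open>0 < \<epsilon>\<close> \<open>0 < t\<^sub>0\<close> by auto
    next
      case False
      then have "x \<in> cball 0 \<rho>" by simp
      then obtain y where y: "y \<in> Y" "x \<in> U y" using Y(2) by blast
      have "softmin H l I x 0 \<le> (u\<^sub>0 y - p y \<bullet> y) + p y \<bullet> x - 0 * H (p y)"
        using y by (intro softmin_le I \<open>0 < l\<close>) (auto simp: I_def)
      with y show ?thesis by (simp add: U_def u_0 inner_diff_right algebra_simps)
    qed
    show "softmin H l I x t - \<epsilon> \<le> u x t" if "\<rho> \<le> norm x" "0 \<le> t" "t \<le> t\<^sub>0 + 1" for x t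
      using far'[OF that] B(2)[of t x] that \<open>0 < \<epsilon>\<close> by auto
  qed (use sub u_cont \<open>0 < t\<^sub>0\<close> in auto)
  moreover have "c - ln (card I) / l \<le> softmin H l I x\<^sub>0 t\<^sub>0"
  proof (rule softmin_ge[OF I \<open>0 < l\<close>])
    fix a q assume "(a, q) \<in> I"
    then show "c \<le> a + q \<bullet> x\<^sub>0 - t\<^sub>0 * H q"
    proof (cases "(a, q) \<in> (\<lambda>b. (C, b)) ` D")
      case True
      then show ?thesis using C_mono by auto
    next
      case False
      with \<open>(a, q) \<in> I\<close> obtain y where "a = u\<^sub>0 y - p y \<bullet> y" "q = p y"
        by (auto simp: I_def)
      with p[of y] show ?thesis by (simp add: inner_diff_right)
    qed
  qed
  ultimately have "c - 2 * \<epsilon> \<le> u x\<^sub>0 t\<^sub>0" using l by simp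
  then show False using \<open>0 < \<epsilon>\<close> by (simp add: \<epsilon>_def field_simps)
qed

section \<open>The Legendre transform\<close>

lemma bounded_on_cball:
  fixes H :: "'a::euclidean_space \<Rightarrow> real"
  assumes "continuous_on UNIV H"
  obtains M where "\<And>p. norm p \<le> r \<Longrightarrow> \<bar>H p\<bar> \<le> M"
proof -
  have "compact (H ` cball 0 r)"
    by (intro compact_continuous_image continuous_on_subset[OF assms]) auto
  then have "bounded (H ` cball 0 r)" by (rule compact_imp_bounded)
  then obtain M where "\<forall>p\<in>cball 0 r. norm (H p) \<le> M"
    unfolding bounded_iff by blast
  then show ?thesis by (intro that[of M]) auto
qed

lemma bdd_above_legendre:
  fixes H :: "'a::euclidean_space \<Rightarrow> real"
  assumes "continuous_on UNIV H" and "strongly_coercive H"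
  shows "bdd_above (range (\<lambda>p. p \<bullet> q - H p))"
proof -
  have "\<forall>\<^sub>F p in at_infinity. norm q \<le> H p / norm p"
    using assms(2) by (simp add: strongly_coercive_def filterlim_at_top)
  then obtain b where b: "\<And>p. b \<le> norm p \<Longrightarrow> norm q \<le> H p / norm p"
    by (auto simp: eventually_at_infinity)
  obtain M where M: "\<And>p. norm p \<le> max b 1 \<Longrightarrow> \<bar>H p\<bar> \<le> M"
    using bounded_on_cball[OF assms(1)] by blast
  have "p \<bullet> q - H p \<le> max b 1 * norm q + M" for p
  proof (cases "norm p \<le> max b 1")
    case True
    have "p \<bullet> q \<le> norm p * norm q" by (rule norm_cauchy_schwarz)
    also have "\<dots> \<le> max b 1 * norm q" using True by (intro mult_right_mono) auto
    finally show ?thesis using M[OF True] by linarith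
  next
    case False
    then have "0 < norm p" "norm q \<le> H p / norm p" using b[of p] by linarith+
    then have "norm p * norm q \<le> H p" by (simp add: pos_le_divide_eq mult.commute)
    moreover have "p \<bullet> q \<le> norm p * norm q" by (rule norm_cauchy_schwarz)
    moreover have "0 \<le> M" using M[of 0] abs_ge_zero[of "H 0"] by (simp add: le_max_iff_disj)
    moreover have "0 \<le> max b 1 * norm q" by simp
    ultimately show ?thesis by linarith
  qed
  then show ?thesis by (intro bdd_aboveI2)
qed

lemma legendre_le: "(\<And>p. p \<bullet> q - H p \<le> c) \<Longrightarrow> legendre H q \<le> c"
  unfolding legendre_def by (intro cSUP_least) auto

lemma legendre_ge:
  fixes H :: "'a::euclidean_space \<Rightarrow> real"
  assumes "continuous_on UNIV H" and "strongly_coercive H"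
  shows "p \<bullet> q - H p \<le> legendre H q"
  unfolding legendre_def by (intro cSUP_upper bdd_above_legendre assms) auto

text \<open>
  A supremum of affine functions is convex, and a finite convex function is continuous.
\<close>

lemma continuous_on_legendre:
  fixes H :: "'a::euclidean_space \<Rightarrow> real"
  assumes "continuous_on UNIV H" and "strongly_coercive H"
  shows "continuous_on UNIV (legendre H)"
proof (rule convex_on_continuous)
  show "convex_on UNIV (legendre H)"
  proof (rule convex_onI)
    fix s :: real and x y :: 'a
    assume s: "0 < s" "s < 1"
    show "legendre H ((1 - s) *\<^sub>R x + s *\<^sub>R y) \<le> (1 - s) * legendre H x + s * legendre H y"
    proof (rule legendre_le)
      fix p
      have "(1 - s) * (p \<bullet> x - H p) + s * (p \<bullet> y - H p) \<le> (1 - s) * legendre H x + s * legendre H y"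
        using s by (intro add_mono mult_left_mono legendre_ge assms) auto
      then show "p \<bullet> ((1 - s) *\<^sub>R x + s *\<^sub>R y) - H p \<le> (1 - s) * legendre H x + s * legendre H y"
        by (simp add: inner_add_right algebra_simps)
    qed
  qed simp
qed simp

text \<open>
  Test the supremum with the slope of norm \<open>c\<close> in the direction of \<open>q\<close>; \<open>C\<close> bounds \<open>H\<close> on the ball of
  radius \<open>c\<close>.
\<close>

lemma legendre_superlinear:
  fixes H :: "'a::euclidean_space \<Rightarrow> real"
  assumes "continuous_on UNIV H" and "strongly_coercive H" and "0 \<le> c"
  obtains C where "\<And>q. c * norm q - C \<le> legendre H q"
proof -
  obtain M where M: "\<And>p. norm p \<le> c \<Longrightarrow> \<bar>H p\<bar> \<le> M"
    using bounded_on_cball[OF assms(1)] by blast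
  have "c * norm q - M \<le> legendre H q" for q
  proof -
    define p where "p = c *\<^sub>R sgn q"
    have "norm p \<le> c" using \<open>0 \<le> c\<close> by (simp add: p_def norm_sgn)
    moreover have "p \<bullet> q = c * norm q"
      by (cases "q = 0") (simp_all add: p_def sgn_div_norm dot_square_norm power2_eq_square)
    ultimately show ?thesis
      using legendre_ge[OF assms(1,2), of p q] M[of p] by auto
  qed
  then show ?thesis by (rule that)
qed

section \<open>Grids and the scheme\<close>

lemma space_grid_node_near:
  assumes "space_grid E vert X"
  shows "\<exists>k. dist x (X k) \<le> mesh_size E"
proof -
  have "x \<in> \<Union>E" using assms by (simp add: space_grid_def)
  then obtain K where K: "K \<in> E" "x \<in> K" by blast
  then have "vert K \<noteq> {}" "vert K \<subseteq> closure K" "bounded K"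
    using assms by (auto simp: space_grid_def)
  then obtain v where v: "v \<in> vert K" "v \<in> closure K" by blast
  have "v \<in> range X" using v K assms by (auto simp: space_grid_def)
  then obtain k where k: "v = X k" by blast
  have "dist x v \<le> diameter (closure K)"
    using v K \<open>bounded K\<close> closure_subset by (intro diameter_bounded_bound bounded_closure) auto
  also have "\<dots> = diameter K" using \<open>bounded K\<close> by (rule diameter_closure)
  also have "\<dots> \<le> mesh_size E"
    unfolding mesh_size_def using K assms by (intro cSUP_upper) (auto simp: space_grid_def)
  finally show ?thesis using k by blast
qed

text \<open>
  A node in \<open>S\<close> lies in the closure of its element, so an open set around the node meets the
  element itself; finitely many such sets cover \<open>S\<close> and each meets only finitely many elements.
\<close>

lemma space_grid_finite_nodes:
  assumes "space_grid E vert X" and "compact S"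
  shows "finite (range X \<inter> S)"
proof -
  have "\<forall>x. \<exists>V. open V \<and> x \<in> V \<and> finite {U \<in> E. U \<inter> V \<noteq> {}}"
    using assms(1) by (simp add: space_grid_def locally_finite_in_def)
  then obtain V where V: "\<And>x. open (V x)" "\<And>x. x \<in> V x" "\<And>x. finite {U \<in> E. U \<inter> V x \<noteq> {}}"
    by metis
  have "S \<subseteq> (\<Union>x\<in>UNIV. V x)" using V(2) by blast
  then obtain Y where Y: "finite Y" "S \<subseteq> (\<Union>x\<in>Y. V x)"
    using compactE_image[OF assms(2), of UNIV V] V(1) by metis
  have "finite (vert K)" if "K \<in> E" for K
    using assms(1) that by (simp add: space_grid_def)
  then have "finite (\<Union>x\<in>Y. \<Union>K\<in>{U \<in> E. U \<inter> V x \<noteq> {}}. vert K)"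
    using Y(1) V(3) by blast
  moreover have "range X \<inter> S \<subseteq> (\<Union>x\<in>Y. \<Union>K\<in>{U \<in> E. U \<inter> V x \<noteq> {}}. vert K)"
  proof
    fix z assume z: "z \<in> range X \<inter> S"
    then obtain x where x: "x \<in> Y" "z \<in> V x" using Y(2) by blast
    from z obtain K where K: "K \<in> E" "z \<in> vert K"
      using assms(1) by (auto simp: space_grid_def)
    then have "z \<in> closure K" using assms(1) by (auto simp: space_grid_def)
    then have "K \<inter> V x \<noteq> {}"
      using V(1)[of x] x(2) open_Int_closure_eq_empty[of "V x" K] by blast
    then show "z \<in> (\<Union>x\<in>Y. \<Union>K\<in>{U \<in> E. U \<inter> V x \<noteq> {}}. vert K)" using x K by blast
  qed
  ultimately show ?thesis by (rule finite_subset[rotated])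
qed

text \<open>
  The enumeration of the nodes may repeat itself; the values of the scheme do not see this.
\<close>

lemma scheme_cong: "X j = X k \<Longrightarrow> scheme H u\<^sub>0 h X n j = scheme H u\<^sub>0 h X n k"
  by (cases n) simp_all

text \<open>
  Since \<open>H\<^sup>*\<close> is coercive and the previous time level is bounded below, only nodes in some ball
  around \<open>X j\<close> can do at least as well as the node \<open>X 0\<close>. There are finitely many of them, so the
  minimum over all nodes is a minimum over a finite set of values.
\<close>

lemma scheme_step_attained:
  fixes X :: "nat \<Rightarrow> 'a::euclidean_space"
  assumes nodes: "\<And>r x. finite (range X \<inter> cball x r)" and "0 < h"
    and coercive: "\<And>q. norm q - C \<le> legendre H q"
    and bound: "\<And>k. m \<le> scheme H u\<^sub>0 h X n k"
  defines "g j k \<equiv> scheme H u\<^sub>0 h X n k + h * legendre H ((X j - X k) /\<^sub>R h)"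
  shows "scheme H u\<^sub>0 h X (Suc n) j \<in> range (g j)" and "scheme H u\<^sub>0 h X (Suc n) j \<le> g j k"
proof -
  define S where "S = {k. g j k \<le> g j 0}"
  define r where "r = g j 0 - m + h * C"
  have "X k \<in> range X \<inter> cball (X j) r" if "k \<in> S" for k
  proof -
    have "h * (norm ((X j - X k) /\<^sub>R h) - C) \<le> h * legendre H ((X j - X k) /\<^sub>R h)"
      using \<open>0 < h\<close> by (intro mult_left_mono coercive) auto
    then have "norm (X j - X k) - h * C \<le> h * legendre H ((X j - X k) /\<^sub>R h)"
      using \<open>0 < h\<close> by (simp add: right_diff_distrib flip: mult.assoc)
    also have "\<dots> \<le> g j 0 - m"
      using that bound[of k] by (simp add: S_def g_def)
    finally show ?thesis by (simp add: r_def dist_norm)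
  qed
  then have "finite (X ` S)"
    using nodes[of "X j" r] by (meson finite_subset image_subsetI)
  \<comment> \<open>\<open>S\<close> itself may be infinite, but \<open>g j k\<close> depends on \<open>k\<close> only through the node \<open>X k\<close>.\<close>
  moreover have "g j ` S \<subseteq> (\<lambda>z. g j (SOME k. X k = z)) ` X ` S"
  proof
    fix w assume "w \<in> g j ` S"
    then obtain k where k: "k \<in> S" "w = g j k" by blast
    have "X (SOME k'. X k' = X k) = X k" by (rule someI) simp
    then have "g j (SOME k'. X k' = X k) = g j k"
      unfolding g_def using scheme_cong[of X "SOME k'. X k' = X k" k] by simp
    then show "w \<in> (\<lambda>z. g j (SOME k. X k = z)) ` X ` S" using k by force
  qed
  ultimately have fin: "finite (g j ` S)" by (meson finite_imageI finite_subset)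
  have "g j 0 \<in> g j ` S" by (simp add: S_def)
  then have "Min (g j ` S) \<in> g j ` S" using fin by (intro Min_in) auto
  moreover have least: "Min (g j ` S) \<le> g j k" for k
  proof (cases "k \<in> S")
    case True
    then show ?thesis using fin by simp
  next
    case False
    then show ?thesis using Min_le[OF fin \<open>g j 0 \<in> g j ` S\<close>] by (simp add: S_def)
  qed
  ultimately have "(LEAST w. w \<in> range (g j)) = Min (g j ` S)"
    by (intro Least_equality) auto
  then have eq: "scheme H u\<^sub>0 h X (Suc n) j = Min (g j ` S)"
    by (simp add: g_def)
  show "scheme H u\<^sub>0 h X (Suc n) j \<in> range (g j)"
    unfolding eq using \<open>Min (g j ` S) \<in> g j ` S\<close> by blast
  show "scheme H u\<^sub>0 h X (Suc n) j \<le> g j k"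
    unfolding eq by (rule least)
qed

text \<open>
  An attained minimum over a level that is bounded below is itself bounded below, by coercivity of
  \<open>H\<^sup>*\<close>; this bound in turn makes the minimum of the following step attained.
\<close>

lemma scheme_bounded_below:
  fixes X :: "nat \<Rightarrow> 'a::euclidean_space"
  assumes nodes: "\<And>r x. finite (range X \<inter> cball x r)" and "0 < h"
    and coercive: "\<And>q. norm q - C \<le> legendre H q"
    and "bounded (range u\<^sub>0)"
  shows "\<exists>m. \<forall>k. m \<le> scheme H u\<^sub>0 h X n k"
proof (induction n)
  case 0
  obtain B where "\<And>x. \<bar>u\<^sub>0 x\<bar> \<le> B" using assms(4) by (auto simp: bounded_iff)
  then have "\<forall>k. - B \<le> scheme H u\<^sub>0 h X 0 k" by (simp add: abs_le_iff minus_le_iff)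
  then show ?case by blast
next
  case (Suc n)
  then obtain m where m: "\<And>k. m \<le> scheme H u\<^sub>0 h X n k" by blast
  have "m - h * C \<le> scheme H u\<^sub>0 h X (Suc n) j" for j
  proof -
    obtain k where k: "scheme H u\<^sub>0 h X (Suc n) j
        = scheme H u\<^sub>0 h X n k + h * legendre H ((X j - X k) /\<^sub>R h)"
      using scheme_step_attained(1)[OF nodes \<open>0 < h\<close> coercive m] by auto
    have "- C \<le> legendre H ((X j - X k) /\<^sub>R h)"
      using coercive[of "(X j - X k) /\<^sub>R h"] norm_ge_zero[of "(X j - X k) /\<^sub>R h"] by linarith
    then have "h * - C \<le> h * legendre H ((X j - X k) /\<^sub>R h)"
      using \<open>0 < h\<close> by (intro mult_left_mono) auto
    with k m[of k] show ?thesis by simp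
  qed
  then show ?case by blast
qed

lemma
  fixes X :: "nat \<Rightarrow> 'a::euclidean_space"
  assumes H: "continuous_on UNIV H" "strongly_coercive H" and grid: "space_grid E vert X"
    and "0 < h" and "bounded (range u\<^sub>0)"
  shows scheme_Suc_attained: "\<exists>k. scheme H u\<^sub>0 h X (Suc n) j
      = scheme H u\<^sub>0 h X n k + h * legendre H ((X j - X k) /\<^sub>R h)"
    and scheme_Suc_le: "scheme H u\<^sub>0 h X (Suc n) j
      \<le> scheme H u\<^sub>0 h X n k + h * legendre H ((X j - X k) /\<^sub>R h)"
proof -
  obtain C where C: "\<And>q. norm q - C \<le> legendre H q"
    using legendre_superlinear[OF H, of 1] by auto
  have nodes: "finite (range X \<inter> cball x r)" for x r
    using space_grid_finite_nodes[OF grid compact_cball] .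
  obtain m where m: "\<And>k. m \<le> scheme H u\<^sub>0 h X n k"
    using scheme_bounded_below[OF nodes \<open>0 < h\<close> C assms(5)] by blast
  note attained = scheme_step_attained[OF nodes \<open>0 < h\<close> C m]
  show "\<exists>k. scheme H u\<^sub>0 h X (Suc n) j = scheme H u\<^sub>0 h X n k + h * legendre H ((X j - X k) /\<^sub>R h)"
    using attained(1) by auto
  show "scheme H u\<^sub>0 h X (Suc n) j \<le> scheme H u\<^sub>0 h X n k + h * legendre H ((X j - X k) /\<^sub>R h)"
    using attained(2) .
qed

text \<open>
  Following minimisers back in time leads from the node \<open>X j\<close> to a starting node \<open>X m\<close>. One slope \<open>p\<close> is
  used for all the steps, so the increments telescope; as \<open>m\<close> does not depend on \<open>p\<close>, the bound is the
  Hopf--Lax value of \<open>X m\<close>.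
\<close>

lemma scheme_ge_hopf_lax:
  fixes X :: "nat \<Rightarrow> 'a::euclidean_space"
  assumes H: "continuous_on UNIV H" "strongly_coercive H" and grid: "space_grid E vert X"
    and "0 < h" and "bounded (range u\<^sub>0)"
  shows "\<exists>m. \<forall>p. u\<^sub>0 (X m) + p \<bullet> (X j - X m) - real n * h * H p \<le> scheme H u\<^sub>0 h X n j"
proof (induction n arbitrary: j)
  case 0
  then show ?case by (auto intro!: exI[of _ j])
next
  case (Suc n)
  obtain k where k: "scheme H u\<^sub>0 h X (Suc n) j
      = scheme H u\<^sub>0 h X n k + h * legendre H ((X j - X k) /\<^sub>R h)"
    using scheme_Suc_attained[OF assms] by blast
  obtain m where m: "\<And>p. u\<^sub>0 (X m) + p \<bullet> (X k - X m) - real n * h * H p \<le> scheme H u\<^sub>0 h X n k"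
    using Suc by blast
  have "u\<^sub>0 (X m) + p \<bullet> (X j - X m) - real (Suc n) * h * H p \<le> scheme H u\<^sub>0 h X (Suc n) j" for p
  proof -
    have "h * (p \<bullet> ((X j - X k) /\<^sub>R h) - H p) \<le> h * legendre H ((X j - X k) /\<^sub>R h)"
      using \<open>0 < h\<close> by (intro mult_left_mono legendre_ge H) auto
    then have "p \<bullet> (X j - X k) - h * H p \<le> h * legendre H ((X j - X k) /\<^sub>R h)"
      using \<open>0 < h\<close> by (simp add: right_diff_distrib flip: mult.assoc)
    with m[of p] show ?thesis
      unfolding k by (simp add: inner_diff_right algebra_simps)
  qed
  then show ?case by blast
qed

lemma scheme_le_along_path:
  fixes X :: "nat \<Rightarrow> 'a::euclidean_space"
  assumes H: "continuous_on UNIV H" "strongly_coercive H" and grid: "space_grid E vert X"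
    and "0 < h" and "bounded (range u\<^sub>0)"
    and cost: "\<And>i. i < n \<Longrightarrow> legendre H ((X (\<kappa> (Suc i)) - X (\<kappa> i)) /\<^sub>R h) \<le> c"
  shows "scheme H u\<^sub>0 h X n (\<kappa> n) \<le> u\<^sub>0 (X (\<kappa> 0)) + real n * h * c"
  using cost
proof (induction n)
  case 0
  then show ?case by simp
next
  case (Suc n)
  have "scheme H u\<^sub>0 h X (Suc n) (\<kappa> (Suc n))
      \<le> scheme H u\<^sub>0 h X n (\<kappa> n) + h * legendre H ((X (\<kappa> (Suc n)) - X (\<kappa> n)) /\<^sub>R h)"
    by (rule scheme_Suc_le[OF assms(1-5)])
  also have "\<dots> \<le> (u\<^sub>0 (X (\<kappa> 0)) + real n * h * c) + h * c"
    using Suc \<open>0 < h\<close> by (intro add_mono mult_left_mono) auto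
  finally show ?case by (simp add: algebra_simps)
qed

section \<open>Convergence\<close>

text \<open>
  The error is uniform in space, over all grids with \<open>\<Delta>x \<le> \<delta>\<close> and \<open>\<Delta>x \<le> \<delta> \<Delta>t\<close>. The first condition
  controls the datum at the starting node of the shadowing path, the second one its velocities.
\<close>

lemma scheme_uniform_error:
  fixes H :: "'a::euclidean_space \<Rightarrow> real"
  assumes conv: "convex_on UNIV H" and coercive: "strongly_coercive H"
    and bdd: "bounded (range u\<^sub>0)" and lip: "L-lipschitz_on UNIV u\<^sub>0"
    and sol: "viscosity_solution H u\<^sub>0 u" and "0 < T" and "0 < \<epsilon>"
  obtains \<delta> where "0 < \<delta>"
    "\<And>E vert X h n j. space_grid E vert X \<Longrightarrow> 0 < h \<Longrightarrow> mesh_size E \<le> \<delta> * h \<Longrightarrow> mesh_size E \<le> \<delta> \<Longrightarrow>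
       real n * h \<le> T \<Longrightarrow> \<bar>scheme H u\<^sub>0 h X n j - u (X j) (real n * h)\<bar> \<le> \<epsilon>"
proof -
  have H_cont: "continuous_on UNIV H"
    using convex_on_continuous[OF open_UNIV conv] .
  note H = H_cont coercive
  have "0 \<le> L" using lip by (simp add: lipschitz_on_def)
  then obtain C where C: "\<And>q. (L + 1) * norm q - C \<le> legendre H q"
    using legendre_superlinear[OF H, of "L + 1"] by auto
  \<comment> \<open>A bound for the velocity \<open>q\<close> of nearly optimal paths: the constant path has cost \<open>t H\<^sup>* 0\<close>, so that
    \<open>H\<^sup>* q \<le> L \<bar>q\<bar> + H\<^sup>* 0 + 1\<close>, whereas \<open>H\<^sup>* q \<ge> (L + 1) \<bar>q\<bar> - C\<close>.\<close>
  define R where "R = C + legendre H 0 + 1"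
  define \<eta> where "\<eta> = \<epsilon> / (4 * T)"
  have "0 < \<eta>" using \<open>0 < \<epsilon>\<close> \<open>0 < T\<close> by (simp add: \<eta>_def)
  have "uniformly_continuous_on (cball 0 (R + 1)) (legendre H)"
    by (intro compact_uniformly_continuous continuous_on_subset[OF continuous_on_legendre[OF H]]) auto
  then obtain \<delta>\<^sub>1 where "0 < \<delta>\<^sub>1" and \<delta>\<^sub>1: "\<And>a b. a \<in> cball 0 (R + 1) \<Longrightarrow> b \<in> cball 0 (R + 1) \<Longrightarrow>
      dist b a < \<delta>\<^sub>1 \<Longrightarrow> dist (legendre H b) (legendre H a) < \<eta>"
    using \<open>0 < \<eta>\<close> unfolding uniformly_continuous_on_def by metis
  define \<delta> where "\<delta> = min (min (1 / 2) (\<delta>\<^sub>1 / 3)) (\<epsilon> / (4 * (L + 1)))"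
  have "0 < \<delta>" using \<open>0 < \<delta>\<^sub>1\<close> \<open>0 < \<epsilon>\<close> \<open>0 \<le> L\<close> by (simp add: \<delta>_def)
  have \<delta>: "2 * \<delta> \<le> 1" "2 * \<delta> < \<delta>\<^sub>1" "L * \<delta> \<le> \<epsilon> / 4"
  proof -
    have "\<delta> \<le> 1 / 2" "\<delta> \<le> \<delta>\<^sub>1 / 3"
      unfolding \<delta>_def by (rule min.coboundedI1[OF min.cobounded1], rule min.coboundedI1[OF min.cobounded2])
    then show "2 * \<delta> \<le> 1" "2 * \<delta> < \<delta>\<^sub>1" using \<open>0 < \<delta>\<^sub>1\<close> by linarith+
    have "L * \<delta> \<le> (L + 1) * (\<epsilon> / (4 * (L + 1)))"
      using \<open>0 \<le> L\<close> \<open>0 < \<delta>\<close> by (intro mult_mono) (auto simp: \<delta>_def)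
    also have "\<dots> = \<epsilon> / 4" using \<open>0 \<le> L\<close> by (simp add: field_simps)
    finally show "L * \<delta> \<le> \<epsilon> / 4" .
  qed
  have "\<bar>scheme H u\<^sub>0 h X n j - u (X j) (real n * h)\<bar> \<le> \<epsilon>"
    if grid: "space_grid E vert X" and "0 < h" and mesh: "mesh_size E \<le> \<delta> * h" "mesh_size E \<le> \<delta>"
      and T: "real n * h \<le> T" for E vert and X :: "nat \<Rightarrow> 'a" and h n j
  proof (cases "n = 0")
    case True
    then show ?thesis using sol \<open>0 < \<epsilon>\<close> by (simp add: viscosity_solution_def)
  next
    case False
    define x where "x = X j"
    define t where "t = real n * h"
    have "0 < t" using False \<open>0 < h\<close> by (simp add: t_def)
    note scheme = H grid \<open>0 < h\<close> bdd
    have lower: "u x t \<le> scheme H u\<^sub>0 h X n j"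
    proof -
      obtain m where "\<And>p. u\<^sub>0 (X m) + p \<bullet> (x - X m) - t * H p \<le> scheme H u\<^sub>0 h X n j"
        using scheme_ge_hopf_lax[OF scheme, of j n] by (auto simp: x_def t_def)
      then show ?thesis by (rule viscosity_solution_le_hopf_lax[OF sol lip \<open>0 < t\<close>])
    qed
    \<comment> \<open>The tolerance must be at most \<open>t\<close>, since the velocity bound comes from dividing the costs by \<open>t\<close>.\<close>
    define \<epsilon>' where "\<epsilon>' = min (\<epsilon> / 4) t"
    have "0 < \<epsilon>'" using \<open>0 < \<epsilon>\<close> \<open>0 < t\<close> by (simp add: \<epsilon>'_def)
    then have "\<exists>y. \<forall>p. u\<^sub>0 y + p \<bullet> (x - y) - t * H p \<le> u x t + \<epsilon>'"
      using hopf_lax_le_viscosity_solution[OF conv sol \<open>0 < t\<close>, of "u x t + \<epsilon>'" x] by (force simp: not_le)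
    then obtain y where y: "\<And>p. u\<^sub>0 y + p \<bullet> (x - y) - t * H p \<le> u x t + \<epsilon>'" by blast
    define q where "q = (x - y) /\<^sub>R t"
    have "x - y = t *\<^sub>R q" using \<open>0 < t\<close> by (simp add: q_def)
    have "legendre H q \<le> (u x t + \<epsilon>' - u\<^sub>0 y) / t"
    proof (rule legendre_le)
      fix p
      show "p \<bullet> q - H p \<le> (u x t + \<epsilon>' - u\<^sub>0 y) / t"
        using y[of p] \<open>0 < t\<close> unfolding \<open>x - y = t *\<^sub>R q\<close> by (simp add: field_simps)
    qed
    then have near_optimal: "u\<^sub>0 y + t * legendre H q \<le> u x t + \<epsilon>'"
      using \<open>0 < t\<close> by (simp add: field_simps)
    have "norm q \<le> R"
    proof -
      have "u x t \<le> u\<^sub>0 x + t * legendre H 0"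
      proof (rule viscosity_solution_le_hopf_lax[OF sol lip \<open>0 < t\<close>])
        show "u\<^sub>0 x + p \<bullet> (x - x) - t * H p \<le> u\<^sub>0 x + t * legendre H 0" for p
          using mult_left_mono[OF legendre_ge[OF H, of p 0], of t] \<open>0 < t\<close> by simp
      qed
      moreover have "u\<^sub>0 x - u\<^sub>0 y \<le> L * (t * norm q)"
        using lipschitz_onD[OF lip, of x y] \<open>x - y = t *\<^sub>R q\<close> \<open>0 < t\<close> by (simp add: dist_norm)
      moreover have "\<epsilon>' \<le> t" by (simp add: \<epsilon>'_def)
      ultimately have "t * legendre H q \<le> t * (L * norm q + legendre H 0 + 1)"
        using near_optimal by (simp add: algebra_simps)
      then have "legendre H q \<le> L * norm q + legendre H 0 + 1" using \<open>0 < t\<close> by simp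
      with C[of q] show ?thesis by (simp add: R_def algebra_simps)
    qed
    define z where "z i = y + (real i * h) *\<^sub>R q" for i
    have "z n = x"
      using \<open>x - y = t *\<^sub>R q\<close> by (simp add: z_def t_def algebra_simps)
    have "\<forall>i. \<exists>k. dist (z i) (X k) \<le> mesh_size E"
      using space_grid_node_near[OF grid] by blast
    then obtain k where k: "\<And>i. dist (z i) (X (k i)) \<le> mesh_size E" by metis
    \<comment> \<open>The shadowing path has to end exactly at the node \<open>X j\<close>.\<close>
    define \<kappa> where "\<kappa> = k(n := j)"
    have \<kappa>: "dist (z i) (X (\<kappa> i)) \<le> mesh_size E" for i
      using k[of i] order_trans[OF zero_le_dist k[of i]] \<open>z n = x\<close> by (auto simp: \<kappa>_def x_def)
    have "scheme H u\<^sub>0 h X n (\<kappa> n) \<le> u\<^sub>0 (X (\<kappa> 0)) + real n * h * (legendre H q + \<eta>)"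
    proof (rule scheme_le_along_path[OF scheme])
      fix i
      define q' where "q' = (X (\<kappa> (Suc i)) - X (\<kappa> i)) /\<^sub>R h"
      have "z (Suc i) - z i = h *\<^sub>R q"
        by (simp add: z_def algebra_simps)
      then have "h *\<^sub>R (q' - q) = (z i - X (\<kappa> i)) - (z (Suc i) - X (\<kappa> (Suc i)))"
        using \<open>0 < h\<close> by (simp add: q'_def algebra_simps)
      then have "h * norm (q' - q) \<le> dist (z i) (X (\<kappa> i)) + dist (z (Suc i)) (X (\<kappa> (Suc i)))"
        using \<open>0 < h\<close> norm_triangle_ineq4[of "z i - X (\<kappa> i)" "z (Suc i) - X (\<kappa> (Suc i))"]
        by (metis dist_norm norm_scaleR abs_of_pos)
      also have "\<dots> \<le> h * (2 * \<delta>)"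
        using \<kappa>[of i] \<kappa>[of "Suc i"] mesh(1) by (simp add: algebra_simps)
      finally have "norm (q' - q) \<le> 2 * \<delta>" using \<open>0 < h\<close> by simp
      moreover have "norm q' \<le> norm q + norm (q' - q)"
        using norm_triangle_ineq[of q "q' - q"] by simp
      ultimately have "dist (legendre H q') (legendre H q) < \<eta>"
        using \<open>norm q \<le> R\<close> \<delta> by (intro \<delta>\<^sub>1) (auto simp: dist_norm)
      then show "legendre H ((X (\<kappa> (Suc i)) - X (\<kappa> i)) /\<^sub>R h) \<le> legendre H q + \<eta>"
        by (simp add: q'_def dist_real_def)
    qed
    then have "scheme H u\<^sub>0 h X n j \<le> u\<^sub>0 (X (\<kappa> 0)) + t * legendre H q + t * \<eta>"
      by (simp add: \<kappa>_def t_def distrib_left)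
    moreover have "u\<^sub>0 (X (\<kappa> 0)) \<le> u\<^sub>0 y + \<epsilon> / 4"
    proof -
      have "u\<^sub>0 (X (\<kappa> 0)) - u\<^sub>0 y \<le> L * dist y (X (\<kappa> 0))"
        using lipschitz_onD[OF lip, of "X (\<kappa> 0)" y] by (simp add: dist_real_def dist_commute)
      also have "\<dots> \<le> L * \<delta>"
        using \<kappa>[of 0] mesh(2) \<open>0 \<le> L\<close> by (intro mult_left_mono) (auto simp: z_def)
      finally show ?thesis using \<delta>(3) by simp
    qed
    moreover have "t * \<eta> \<le> \<epsilon> / 4"
      using mult_right_mono[of t T \<eta>] T \<open>0 < \<eta>\<close> \<open>0 < T\<close> by (simp add: t_def \<eta>_def)
    moreover have "\<epsilon>' \<le> \<epsilon> / 4" by (simp add: \<epsilon>'_def)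
    ultimately have "scheme H u\<^sub>0 h X n j \<le> u x t + \<epsilon>"
      using near_optimal \<open>0 < \<epsilon>\<close> by linarith
    with lower \<open>0 < \<epsilon>\<close> show ?thesis by (simp add: x_def t_def abs_le_iff)
  qed
  with \<open>0 < \<delta>\<close> show ?thesis by (rule that)
qed

lemma convex_on_UNIV_if_strictly_convex:
  assumes "strictly_convex f"
  shows "convex_on UNIV f"
proof (rule convex_onI)
  fix s :: real and x y
  assume "0 < s" "s < 1"
  show "f ((1 - s) *\<^sub>R x + s *\<^sub>R y) \<le> (1 - s) * f x + s * f y"
  proof (cases "x = y")
    case True
    then show ?thesis by (simp flip: scaleR_left_distrib distrib_right)
  next
    case False
    then show ?thesis
      using assms \<open>0 < s\<close> \<open>s < 1\<close> unfolding strictly_convex_def by (simp add: less_imp_le)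
  qed
qed simp

theorem theorem1:
  fixes H :: "real ^ 'd \<Rightarrow> real"
    and D2H :: "real ^ 'd \<Rightarrow> real ^ 'd ^ 'd"
    and M\<^sub>H :: real
    and u\<^sub>0 :: "real ^ 'd \<Rightarrow> real"
    and u :: "real ^ 'd \<Rightarrow> real \<Rightarrow> real"
    and F :: "'i filter"
    and \<Delta>t :: "'i \<Rightarrow> real"
    and E :: "'i \<Rightarrow> (real ^ 'd) set set"
    and vert :: "'i \<Rightarrow> (real ^ 'd) set \<Rightarrow> (real ^ 'd) set"
    and X :: "'i \<Rightarrow> nat \<Rightarrow> real ^ 'd"
    and K :: "(real ^ 'd) set"
    and T :: real
  assumes "C2_with_hessian H D2H"
    and "\<And>p. onorm (\<lambda>h. D2H p *v h) \<le> M\<^sub>H"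
    and "strictly_convex H"
    and "strongly_coercive H"
    and "bounded (range u\<^sub>0)"
    and "\<exists>L. L-lipschitz_on UNIV u\<^sub>0"
    and "viscosity_solution H u\<^sub>0 u"
    and "\<And>i. 0 < \<Delta>t i"
    and "\<And>i. space_grid (E i) (vert i) (X i)"
    and "(\<Delta>t \<longlongrightarrow> 0) F"
    and "((\<lambda>i. mesh_size (E i)) \<longlongrightarrow> 0) F"
    and "(\<lambda>i. mesh_size (E i)) \<in> o[F](\<Delta>t)"
    and "0 < T"
    and "compact K"
  shows "((\<lambda>i. local_error u (\<Delta>t i) (X i) (scheme H u\<^sub>0 (\<Delta>t i) (X i)) K T) \<longlongrightarrow> 0) F"
proof (rule order_tendstoI)
  fix a :: ennreal assume "0 < a"
  then obtain b where b: "0 < b" "b < a" using dense by blast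
  define \<epsilon> where "\<epsilon> = enn2real b"
  have "b \<noteq> top" using b(2) by auto
  then have "b = ennreal \<epsilon>" by (simp add: \<epsilon>_def less_top)
  then have "0 < \<epsilon>" using b(1) by (simp add: ennreal_less_zero_iff)
  obtain L where "L-lipschitz_on UNIV u\<^sub>0" using assms(6) by blast
  obtain \<delta> where "0 < \<delta>" and \<delta>: "\<And>E vert X h n j. space_grid E vert X \<Longrightarrow> 0 < h \<Longrightarrow>
      mesh_size E \<le> \<delta> * h \<Longrightarrow> mesh_size E \<le> \<delta> \<Longrightarrow> real n * h \<le> T \<Longrightarrow>
      \<bar>scheme H u\<^sub>0 h X n j - u (X j) (real n * h)\<bar> \<le> \<epsilon>"
    using scheme_uniform_error[OF convex_on_UNIV_if_strictly_convex[OF assms(3)] assms(4,5)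
        \<open>L-lipschitz_on UNIV u\<^sub>0\<close> assms(7) \<open>0 < T\<close> \<open>0 < \<epsilon>\<close>] by metis
  have "\<forall>\<^sub>F i in F. norm (mesh_size (E i)) \<le> \<delta> * norm (\<Delta>t i)"
    using landau_o.smallD[OF assms(12) \<open>0 < \<delta>\<close>] by simp
  moreover have "\<forall>\<^sub>F i in F. mesh_size (E i) < \<delta>"
    using order_tendstoD(2)[OF assms(11) \<open>0 < \<delta>\<close>] .
  ultimately show "\<forall>\<^sub>F i in F. local_error u (\<Delta>t i) (X i) (scheme H u\<^sub>0 (\<Delta>t i) (X i)) K T < a"
  proof eventually_elim
    case (elim i)
    have "\<bar>scheme H u\<^sub>0 (\<Delta>t i) (X i) n j - u (X i j) (real n * \<Delta>t i)\<bar> \<le> \<epsilon>"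
      if "real n * \<Delta>t i \<le> T" for n j
      using elim assms(8)[of i] that by (intro \<delta>[OF assms(9)[of i]]) auto
    then have "local_error u (\<Delta>t i) (X i) (scheme H u\<^sub>0 (\<Delta>t i) (X i)) K T \<le> ennreal \<epsilon>"
      unfolding local_error_def by (intro SUP_least) (auto intro!: ennreal_leI)
    with b \<open>b = ennreal \<epsilon>\<close> show ?case by simp
  qed
qed simp

end
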